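(* Let $\mathcal{A}$, $\mathcal{M}$, $\mathcal{N}$ be Boolean tensors of sizes $I_1\times\cdots\times I_M\times J_1\times\cdots\times J_N$, $I_1\times\cdots\times I_M\times I_1\times\cdots\times I_M$ and $J_1\times\cdots\times J_N\times J_1\times\cdots\times J_N$ respectively, with $\mathfrak{R}(\mathcal{A})=\mathfrak{R}(\mathcal{A}*_N\mathcal{N})$ and $\mathfrak{R}(\mathcal{A}^T)=\mathfrak{R}(\mathcal{A}^T*_M\mathcal{M}^T)$. If $\mathcal{M}\geq\mathcal{I}$ and $\mathcal{N}\geq\mathcal{I}$, then the existence of the weighted Moore-Penrose inverse $\mathcal{A}^{\dagger}_{\mathcal{M},\mathcal{N}}$ is equivalent to any one of the following conditions (i.e. to each of them individually): (a) $\mathcal{A}*_N\mathcal{N}*_N\mathcal{A}^T*_M\mathcal{M}*_M\mathcal{A}=\mathcal{A}$; (b) $\mathcal{A}*_N\mathcal{N}^T*_N\mathcal{A}^T*_M\mathcal{M}*_M\mathcal{A}=\mathcal{A}$; (c) $\mathcal{A}*_N\mathcal{N}*_N\mathcal{A}^T*_M\mathcal{M}^T*_M\mathcal{A}=\mathcal{A}$; (d) $\mathcal{A}*_N\mathcal{N}^T*_N\mathcal{A}^T*_M\mathcal{M}^T*_M\mathcal{A}=\mathcal{A}$. In particular (when it exists), $\mathcal{A}^{\dagger}_{\mathcal{M},\mathcal{N}}=\mathcal{N}^T*_N\mathcal{A}^T*_M\mathcal{M}^T$.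
   Context: A Boolean tensor is an array with entries in $\{0,1\}$; entries are added and multiplied by the rules of the binary Boolean algebra ($1+1=1$, otherwise as usual). For $\mathcal{A}$ of size $I_1\times\cdots\times I_M\times J_1\times\cdots\times J_N$ and $\mathcal{B}$ of size $J_1\times\cdots\times J_N\times K_1\times\cdots\times K_L$, the Einstein product $\mathcal{A}*_N\mathcal{B}$ has entries $\sum_{j_1,\dots,j_N}a_{i_1\ldots i_Mj_1\ldots j_N}b_{j_1\ldots j_Nk_1\ldots k_L}$ (Boolean sum; the $k$-indices may be absent); the subscript of $*$ is the number of contracted indices (the integers $M,N$ are unrelated to the tensors $\mathcal{M},\mathcal{N}$). The transpose is $(\mathcal{A}^T)_{j_1\ldots j_Ni_1\ldots i_M}=a_{i_1\ldots i_Mj_1\ldots j_N}$. $\mathcal{I}$ is the identity tensor of the appropriate size ($(\mathcal{I})_{i_1\ldots i_Mj_1\ldots j_M}=\prod_k\delta_{i_kj_k}$), and $\ge$ is entrywise. The range is $\mathfrak{R}(\mathcal{A})=\{\mathcal{A}*_N\mathcal{X}:\mathcal{X}\text{ a Boolean tensor of size }J_1\times\cdots\times J_N\}$. A weighted Moore-Penrose inverse $\mathcal{A}^{\dagger}_{\mathcal{M},\mathcal{N}}$ is a Boolean tensor $\mathcal{Z}$ of size $J_1\times\cdots\times J_N\times I_1\times\cdots\times I_M$ with (1) $\mathcal{A}*_N\mathcal{Z}*_M\mathcal{A}=\mathcal{A}$, (2) $\mathcal{Z}*_M\mathcal{A}*_N\mathcal{Z}=\mathcal{Z}$, (3) $(\mathcal{M}*_M\mathcal{A}*_N\mathcal{Z})^T=\mathcal{M}*_M\mathcal{A}*_N\mathcal{Z}$,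 (4) $(\mathcal{Z}*_M\mathcal{A}*_N\mathcal{N})^T=\mathcal{Z}*_M\mathcal{A}*_N\mathcal{N}$. *)

theory Defs
  imports Main
begin

text \<open>
  A multi-index \<open>i\<^sub>1 \<dots> i\<^sub>p\<close> into an array of size \<open>d\<^sub>1 \<times> \<dots> \<times> d\<^sub>p\<close> is a list of naturals,
  counted from 0 in every mode.  The order \<open>p\<close> is the length of the list of dimensions.
\<close>

definition multi_indices :: "nat list \<Rightarrow> nat list set" where
  "multi_indices ds = {is. list_all2 (<) is ds}"

text \<open>
  The binary Boolean algebra is the type \<^typ>\<open>bool\<close>: \<open>0\<close>, \<open>1\<close>, \<open>+\<close>, \<open>\<cdot>\<close> are \<^const>\<open>False\<close>, \<^const>\<open>True\<close>,
  disjunction and conjunction, so a finite Boolean sum is a bounded existential quantifier.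
  A tensor carries its size; its entries are normalised to \<^const>\<open>False\<close> outside
  the index set, so that equality of tensors means equal size and equal entries.
\<close>

typedef btensor =
  "{(ds :: nat list, a :: nat list \<Rightarrow> bool). \<forall>is. is \<notin> multi_indices ds \<longrightarrow> \<not> a is}"
  by (rule exI [of _ "([], \<lambda>_. False)"]) simp

definition dims :: "btensor \<Rightarrow> nat list" where
  "dims A = fst (Rep_btensor A)"

definition entry :: "btensor \<Rightarrow> nat list \<Rightarrow> bool" where
  "entry A = snd (Rep_btensor A)"

abbreviation order_of :: "btensor \<Rightarrow> nat" where
  "order_of A \<equiv> length (dims A)"

definition tensor :: "nat list \<Rightarrow> (nat list \<Rightarrow> bool) \<Rightarrow> btensor" where
  "tensor ds a = Abs_btensor (ds, \<lambda>is. is \<in> multi_indices ds \<and> a is)"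

lemma dims_tensor [simp]: "dims (tensor ds a) = ds"
  by (simp add: dims_def tensor_def Abs_btensor_inverse)

lemma entry_tensor [simp]: "entry (tensor ds a) is \<longleftrightarrow> is \<in> multi_indices ds \<and> a is"
  by (simp add: entry_def tensor_def Abs_btensor_inverse)

lemma entry_outside: "is \<notin> multi_indices (dims A) \<Longrightarrow> \<not> entry A is"
  using Rep_btensor [of A] by (auto simp: dims_def entry_def split: prod.splits)

lemma btensor_eqI:
  assumes "dims A = dims B"
    and "\<And>is. is \<in> multi_indices (dims A) \<Longrightarrow> entry A is = entry B is"
  shows "A = B"
proof -
  have "entry A = entry B"
  proof
    fix "is"
    show "entry A is = entry B is"
      using assms entry_outside [of "is" A] entry_outside [of "is" B]
      by (cases "is \<in> multi_indices (dims A)") auto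
  qed
  with assms(1) show ?thesis
    by (metis Rep_btensor_inject dims_def entry_def prod.collapse)
qed

instantiation btensor :: order
begin

definition less_eq_btensor :: "btensor \<Rightarrow> btensor \<Rightarrow> bool" where
  "A \<le> B \<longleftrightarrow> dims A = dims B \<and> (\<forall>is \<in> multi_indices (dims A). entry A is \<le> entry B is)"

definition less_btensor :: "btensor \<Rightarrow> btensor \<Rightarrow> bool" where
  "(A :: btensor) < B \<longleftrightarrow> A \<le> B \<and> \<not> B \<le> A"

instance
proof
  fix A B :: btensor
  assume "A \<le> B" and "B \<le> A"
  then show "A = B"
    by (intro btensor_eqI) (auto simp: less_eq_btensor_def)
qed (auto simp: less_eq_btensor_def less_btensor_def)

end

text \<open>
  The Einstein product contracts the last \<open>n\<close> modes of \<open>A\<close> with the first \<open>n\<close> modes of \<open>B\<close>.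
  It is meant for tensors whose contracted dimensions agree, i.e. \<open>dims A = Is @ Js\<close>,
  \<open>dims B = Js @ Ks\<close> and \<open>n = length Js\<close>, where \<open>Ks\<close> may be empty.
\<close>

definition einstein :: "btensor \<Rightarrow> nat \<Rightarrow> btensor \<Rightarrow> btensor"
    ("(_ \<star>\<^bsub>_\<^esub> _)" [70, 0, 71] 70) where
  "A \<star>\<^bsub>n\<^esub> B =
    (let m = order_of A - n in
     tensor (take m (dims A) @ drop n (dims B))
       (\<lambda>is. \<exists>js \<in> multi_indices (drop m (dims A)).
          entry A (take m is @ js) \<and> entry B (js @ drop m is)))"

text \<open>
  \<open>ttranspose m A\<close> is the transpose of \<open>A\<close> when the first \<open>m\<close> modes are regarded as row modes and the
  remaining ones as column modes.
\<close>

definition ttranspose :: "nat \<Rightarrow> btensor \<Rightarrow> btensor" where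
  "ttranspose m A =
    (let n = order_of A - m in
     tensor (drop m (dims A) @ take m (dims A))
       (\<lambda>is. entry A (drop n is @ take n is)))"

definition ident :: "nat list \<Rightarrow> btensor" where
  "ident Is = tensor (Is @ Is) (\<lambda>is. \<forall>k < length Is. is ! k = is ! (length Is + k))"

text \<open>Range of \<open>A\<close>, with the last \<open>n\<close> modes regarded as column modes.\<close>

definition trange :: "nat \<Rightarrow> btensor \<Rightarrow> btensor set" where
  "trange n A = {A \<star>\<^bsub>n\<^esub> X | X. dims X = drop (order_of A - n) (dims A)}"

text \<open>
  \<open>weighted_MP m n A M N Z\<close>: the tensor \<open>Z\<close> is a weighted Moore-Penrose inverse of \<open>A\<close>, which has
  \<open>m\<close> row modes and \<open>n\<close> column modes, with respect to the weights \<open>M\<close> and \<open>N\<close>.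
\<close>

definition weighted_MP ::
    "nat \<Rightarrow> nat \<Rightarrow> btensor \<Rightarrow> btensor \<Rightarrow> btensor \<Rightarrow> btensor \<Rightarrow> bool" where
  "weighted_MP m n A M N Z \<longleftrightarrow>
     dims Z = drop m (dims A) @ take m (dims A) \<and>
     A \<star>\<^bsub>n\<^esub> Z \<star>\<^bsub>m\<^esub> A = A \<and>
     Z \<star>\<^bsub>m\<^esub> A \<star>\<^bsub>n\<^esub> Z = Z \<and>
     ttranspose m (M \<star>\<^bsub>m\<^esub> A \<star>\<^bsub>n\<^esub> Z) = M \<star>\<^bsub>m\<^esub> A \<star>\<^bsub>n\<^esub> Z \<and>
     ttranspose n (Z \<star>\<^bsub>m\<^esub> A \<star>\<^bsub>n\<^esub> N) = Z \<star>\<^bsub>m\<^esub> A \<star>\<^bsub>n\<^esub> N"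

end

theory Submission
  imports Defs
begin

text \<open>
  A Boolean tensor with designated row and column modes is a relation between row and column
  multi-indices.  The Einstein product is then relational composition, the transpose is the
  converse, \<open>M \<ge> \<I>\<close> says that \<open>M\<close> is reflexive, and the two equalities of ranges provide
  factorisations \<open>A = X M A\<close> and \<open>A = A N Y\<close>.  So everything is a statement about finite
  relations, and the tensors return only in the last section.

  The inclusion \<open>A \<subseteq> A A\<^sup>T A\<close> holds for every relation.  With reflexive weights, each of the four
  conditions therefore splits into the two conditions \<open>A N A\<^sup>T A = A\<close> and
  \<open>A A\<^sup>T M A = A\<close> (\<open>absorb_weight_iff\<close>), and each of these is insensitive to transposing its weight
  (\<open>absorb_right_weight_converse\<close>, \<open>absorb_left_weight_converse_iff\<close>).  This makes the four
  conditions equivalent.  When they hold, \<open>A N A\<^sup>T\<close> and \<open>A\<^sup>T M A\<close> collapse to the symmetric relations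
  \<open>A A\<^sup>T\<close> and \<open>A\<^sup>T A\<close>, from which it follows that \<open>N\<^sup>T A\<^sup>T M\<^sup>T\<close> is a weighted Moore-Penrose inverse
  (\<open>regular_imp_weighted_MP_rel\<close>).

  The substance lies in the other direction (\<open>weighted_MP_rel_imp_regular\<close>).  If \<open>Z\<close> is a weighted
  Moore-Penrose inverse, then \<open>E = A Z\<close> is a finite idempotent and \<open>P = M A Z\<close> is a symmetric relation
  that contains \<open>E\<close> and whose rows generate the same lattice of unions as the rows of \<open>E\<close>.  A finite
  idempotent is governed by its points \<open>k\<close> with \<open>(k, k) \<in> E\<close>, on which it is a preorder.  There the
  rows of \<open>E\<close> are principal up-sets, hence irreducible under union, so each of them is itself a row
  of \<open>P\<close>, and symmetry of \<open>P\<close> forces \<open>P\<close> and \<open>E\<close> to have the same rows at these points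
  (\<open>symmetric_agrees_on_reflexive_rows\<close>).  In particular \<open>E\<close> is an equivalence relation on its
  reflexive points, and so is \<open>Z A\<close> by duality.  Restricted to these points and modulo the two
  equivalences, \<open>A\<close> and \<open>Z\<close> are mutually inverse Boolean matrices, that is, a bijection and its
  inverse.  For a bijection \<open>A A\<^sup>T A = A\<close>, and factoring through the reflexive points
  lifts this to \<open>A N A\<^sup>T M A = A\<close>.  Once this is known, the four defining equations rewrite
  \<open>N\<^sup>T A\<^sup>T M\<^sup>T\<close> into \<open>Z\<close> (\<open>weighted_MP_rel_unique\<close>).
\<close>

section \<open>Relations with a weighted Moore-Penrose inverse\<close>

definition weighted_MP_rel ::
    "('a \<times> 'b) set \<Rightarrow> ('a \<times> 'a) set \<Rightarrow> ('b \<times> 'b) set \<Rightarrow> ('b \<times> 'a) set \<Rightarrow> bool" where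
  "weighted_MP_rel A M N Z \<longleftrightarrow>
     A O Z O A = A \<and> Z O A O Z = Z \<and> sym (M O A O Z) \<and> sym (Z O A O N)"

lemma subset_relcomp_weights:
  assumes "Id_on (Domain A) \<subseteq> M" and "Id_on (Range A) \<subseteq> N"
  shows "A \<subseteq> A O N O A\<inverse> O M O A"
proof (rule subrelI)
  fix i j assume ij: "(i, j) \<in> A"
  then have "(i, i) \<in> M" "(j, j) \<in> N"
    using assms by blast+
  with ij show "(i, j) \<in> A O N O A\<inverse> O M O A"
    by blast
qed

text \<open>
  An idempotent relation is transitive and dense.  If no point between \<open>x\<close> and \<open>y\<close> were
  reflexive, the relation would be a strict order on the finite nonempty set of points between
  them; but density puts another point below a minimal one.
\<close>

lemma idempotent_reflexive_interpolation:
  assumes "finite E" and idem: "E O E = E" and xy: "(x, y) \<in> E"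
  shows "\<exists>k. (x, k) \<in> E \<and> (k, k) \<in> E \<and> (k, y) \<in> E"
proof (rule ccontr)
  assume none: "\<nexists>k. (x, k) \<in> E \<and> (k, k) \<in> E \<and> (k, y) \<in> E"
  define K where "K = {k. (x, k) \<in> E \<and> (k, y) \<in> E}"
  have trans: "(a, c) \<in> E" if "(a, b) \<in> E" "(b, c) \<in> E" for a b c
    using that idem by blast
  have irrefl: "(k, k) \<notin> E" if "k \<in> K" for k
    using that none unfolding K_def by blast
  have "finite K"
    by (rule finite_subset [of _ "snd ` E"]) (use \<open>finite E\<close> in \<open>force simp: K_def\<close>)+
  moreover have "K \<noteq> {}"
    using xy idem unfolding K_def by blast
  moreover have "asymp_on K (\<lambda>a b. (a, b) \<in> E)"
    using irrefl trans by (blast intro: asymp_onI)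
  moreover have "transp_on K (\<lambda>a b. (a, b) \<in> E)"
    using trans by (blast intro: transp_onI)
  ultimately obtain k where k: "k \<in> K" and minimal: "\<And>l. l \<in> K \<Longrightarrow> l \<noteq> k \<Longrightarrow> (l, k) \<notin> E"
    using Finite_Set.bex_min_element [of K "\<lambda>a b. (a, b) \<in> E"] by blast
  from k idem obtain l where l: "(x, l) \<in> E" "(l, k) \<in> E"
    unfolding K_def by blast
  with k trans have "l \<in> K"
    unfolding K_def by blast
  with l k minimal irrefl show False
    by blast
qed

text \<open>
  The hypotheses make every row of \<open>P\<close> closed under \<open>E\<close> and make the rows of \<open>P\<close> increase along
  \<open>E\<close>, and each row of \<open>E\<close> is a union of rows of \<open>P\<close>.  The proof finds a reflexive point
  \<open>k'\<close> above \<open>k\<close> whose row in \<open>P\<close> lies inside the row of \<open>k\<close> in \<open>E\<close>; as the rows of \<open>P\<close> increase,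
  the row of \<open>k\<close> in \<open>P\<close> lies there too.
\<close>

lemma symmetric_agrees_on_reflexive_rows:
  assumes "finite E" and idem: "E O E = E"
    and "sym P" and PE: "P O E = P" and "E \<subseteq> P" and "E = X O P"
    and k: "(k, k) \<in> E" and "(k, j) \<in> P"
  shows "(k, j) \<in> E"
proof -
  have P_sym: "(b, a) \<in> P" if "(a, b) \<in> P" for a b
    using that \<open>sym P\<close> by (auto dest: symD)
  have mono: "(b, c) \<in> P" if "(a, b) \<in> E" "(a, c) \<in> P" for a b c
    using that P_sym PE by blast
  \<comment> \<open>The row of \<open>i\<close> in \<open>P\<close> lies in the row of \<open>k\<close> in \<open>E\<close>, but \<open>i\<close> need not be reflexive; it is
    replaced below by a reflexive point under it.\<close>
  obtain i where i: "(k, i) \<in> X" "(i, k) \<in> P"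
    using k \<open>E = X O P\<close> by blast
  have "(k, i) \<in> P"
    using i P_sym by blast
  then obtain h where "(k, h) \<in> P" "(h, i) \<in> E"
    using PE by blast
  then obtain k' where "(h, k') \<in> E" and k': "(k', k') \<in> E" "(k', i) \<in> E"
    using idempotent_reflexive_interpolation [OF \<open>finite E\<close> idem] by metis
  have row: "(k, c) \<in> E" if "(k', c) \<in> P" for c
    using mono [OF k'(2) that] i(1) \<open>E = X O P\<close> by blast
  then have "(k, k') \<in> E"
    using k'(1) \<open>E \<subseteq> P\<close> by blast
  then have "(k', j) \<in> P"
    using mono \<open>(k, j) \<in> P\<close> by blast
  then show ?thesis
    by (rule row)
qed

text \<open>
  Transposition exchanges the roles of the two weights, so that facts about \<open>A Z\<close> and \<open>M\<close> carry over
  to \<open>Z A\<close> and \<open>N\<close>.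
\<close>

lemma weighted_MP_rel_converse:
  assumes "weighted_MP_rel A M N Z"
  shows "weighted_MP_rel (A\<inverse>) (N\<inverse>) (M\<inverse>) (Z\<inverse>)"
proof -
  have "(A O Z O A)\<inverse> = A\<inverse>" "(Z O A O Z)\<inverse> = Z\<inverse>"
    "(M O A O Z)\<inverse> = M O A O Z" "(Z O A O N)\<inverse> = Z O A O N"
    using assms by (auto simp only: weighted_MP_rel_def sym_conv_converse_eq)
  then show ?thesis
    by (simp add: weighted_MP_rel_def sym_conv_converse_eq converse_relcomp O_assoc)
qed

lemma weighted_MP_rel_reflexive_rows:
  assumes "weighted_MP_rel A M N Z" and "finite A" and "finite Z"
    and "Id_on (Domain A) \<subseteq> M" and "A = X O M O A"
    and k: "(k, k) \<in> A O Z" and "(k, j) \<in> M O A O Z"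
  shows "(k, j) \<in> A O Z"
proof (rule symmetric_agrees_on_reflexive_rows [OF _ _ _ _ _ _ k])
  show "finite (A O Z)"
    using assms by (simp add: finite_relcomp)
  show "(A O Z) O A O Z = A O Z"
    using assms(1) unfolding weighted_MP_rel_def by (metis O_assoc)
  show "sym (M O A O Z)"
    using assms(1) unfolding weighted_MP_rel_def by blast
  show "(M O A O Z) O A O Z = M O A O Z"
    using assms(1) unfolding weighted_MP_rel_def by (metis O_assoc)
  show "A O Z \<subseteq> M O A O Z"
    using assms(4) by blast
  show "A O Z = X O M O A O Z"
    using assms(5) by (metis O_assoc)
qed fact

text \<open>
  A pair of the left-hand side
  is a path through \<open>A\<close>, \<open>N\<close>, \<open>A\<^sup>T\<close>, \<open>M\<close>, \<open>A\<close>.  The symmetry of \<open>Z A N\<close> removes the step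
  through \<open>N\<close> in favour of a column \<open>l\<close> that is reflexive for \<open>Z A\<close>, and the symmetry of \<open>M A Z\<close>
  removes the step through \<open>M\<close> in favour of a row \<open>k\<close> that is reflexive for \<open>A Z\<close>.  A
  reflexive row \<open>h\<close> with \<open>(l, h) \<in> Z\<close> is then equivalent to \<open>k\<close>, which closes the path.
\<close>

lemma weighted_MP_rel_imp_regular:
  assumes MP: "weighted_MP_rel A M N Z" and "finite A" and "finite Z"
    and M: "Id_on (Domain A) \<subseteq> M" and N: "Id_on (Range A) \<subseteq> N"
    and X: "A = X O M O A" and Y: "A = A O N O Y"
  shows "A O N O A\<inverse> O M O A = A"
proof
  have AZA: "A O Z O A = A" and ZAZ: "Z O A O Z = Z"
    and symP: "sym (M O A O Z)" and symQ: "sym (Z O A O N)"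
    using MP unfolding weighted_MP_rel_def by auto
  have finE: "finite (A O Z)" and finF: "finite (Z O A)"
    using assms by (simp_all add: finite_relcomp)
  have idemE: "(A O Z) O A O Z = A O Z" and idemF: "(Z O A) O Z O A = Z O A"
    using AZA by (metis O_assoc)+
  have EA: "(A O Z) O A = A" and AF: "A O Z O A = A"
    using AZA by (simp_all add: O_assoc)
  have ZE: "Z O (A O Z) = Z"
    using ZAZ by simp
  have PE: "(M O A O Z) O A O Z = M O A O Z" and FQ: "(Z O A) O Z O A O N = Z O A O N"
    using AZA by (metis O_assoc)+
  have rowsP: "(k, j) \<in> A O Z" if "(k, k) \<in> A O Z" "(k, j) \<in> M O A O Z" for k j
    using weighted_MP_rel_reflexive_rows [OF MP \<open>finite A\<close> \<open>finite Z\<close> M X] that .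
  have Y': "A\<inverse> = Y\<inverse> O N\<inverse> O A\<inverse>"
    using Y by (metis converse_relcomp O_assoc)
  have colsQ: "(j, l) \<in> Z O A" if "(l, l) \<in> Z O A" "(l, j) \<in> Z O A O N" for l j
  proof -
    have "(l, j) \<in> N\<inverse> O A\<inverse> O Z\<inverse>"
      using that(2) symQ by (metis converse_iff converse_relcomp O_assoc symD)
    moreover have "(l, l) \<in> A\<inverse> O Z\<inverse>"
      using that(1) by blast
    moreover have "Id_on (Domain (A\<inverse>)) \<subseteq> N\<inverse>"
      using N by blast
    ultimately have "(l, j) \<in> A\<inverse> O Z\<inverse>"
      using weighted_MP_rel_reflexive_rows [OF weighted_MP_rel_converse [OF MP] _ _ _ Y']
        \<open>finite A\<close> \<open>finite Z\<close> by simp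
    then show ?thesis by blast
  qed
  show "A O N O A\<inverse> O M O A \<subseteq> A"
  proof clarify
    fix i j1 j2 i1 i2 j
    assume "(i, j1) \<in> A" "(j1, j2) \<in> N" and i1j2: "(i1, j2) \<in> A"
      and "(i1, i2) \<in> M" "(i2, j) \<in> A"
    \<comment> \<open>The rows \<open>i\<close> and \<open>i1\<close> share the reflexive column \<open>l\<close>.\<close>
    have "(i, j2) \<in> A O Z O A O N"
      using \<open>(i, j1) \<in> A\<close> \<open>(j1, j2) \<in> N\<close> AZA by (metis O_assoc relcompI)
    then obtain l0 where "(i, l0) \<in> A" "(l0, j2) \<in> Z O A O N"
      by blast
    from \<open>(i, l0) \<in> A\<close> AF obtain l1 where "(i, l1) \<in> A" "(l1, l0) \<in> Z O A"
      by blast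
    then obtain l where "(l1, l) \<in> Z O A" and l: "(l, l) \<in> Z O A" and "(l, l0) \<in> Z O A"
      using idempotent_reflexive_interpolation [OF finF idemF] by metis
    have il: "(i, l) \<in> A"
      using \<open>(i, l1) \<in> A\<close> \<open>(l1, l) \<in> Z O A\<close> AF by blast
    have "(l, j2) \<in> Z O A O N"
      using \<open>(l, l0) \<in> Z O A\<close> \<open>(l0, j2) \<in> Z O A O N\<close> FQ by blast
    then have "(j2, l) \<in> Z O A"
      using colsQ l by blast
    then have i1l: "(i1, l) \<in> A"
      using i1j2 AF by blast
    \<comment> \<open>The columns \<open>l\<close> and \<open>j\<close> share the reflexive row \<open>k\<close>.\<close>
    then obtain h0 where "(i1, h0) \<in> A O Z" "(h0, l) \<in> A"
      using EA by blast
    then obtain k where i1k: "(i1, k) \<in> A O Z" and k: "(k, k) \<in> A O Z" and "(k, h0) \<in> A O Z"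
      using idempotent_reflexive_interpolation [OF finE idemE] by metis
    then have kl: "(k, l) \<in> A"
      using EA \<open>(h0, l) \<in> A\<close> by blast
    have "(i1, j) \<in> (M O A O Z) O A"
      using \<open>(i1, i2) \<in> M\<close> \<open>(i2, j) \<in> A\<close> AZA by (metis O_assoc relcompI)
    then obtain i3 where "(i1, i3) \<in> M O A O Z" "(i3, j) \<in> A"
      by blast
    then have "(i3, i1) \<in> M O A O Z"
      using symP by (meson symD)
    then have "(i3, k) \<in> (M O A O Z) O A O Z"
      using i1k by (rule relcompI)
    then have "(i3, k) \<in> M O A O Z"
      unfolding PE .
    then have "(k, i3) \<in> A O Z"
      using symP rowsP k by (meson symD)
    then have kj: "(k, j) \<in> A"
      using \<open>(i3, j) \<in> A\<close> EA by blast
    \<comment> \<open>Through \<open>l\<close>, the rows \<open>k\<close> and \<open>i\<close> lie below a row \<open>h\<close>, chosen reflexive so that symmetry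
      gives \<open>(h, k) \<in> A O Z\<close>.\<close>
    obtain g0 where "(l, g0) \<in> Z" "(g0, l) \<in> A"
      using l by blast
    then obtain g1 where "(g0, g1) \<in> A O Z" "(g1, l) \<in> A"
      using EA by blast
    then obtain h where "(g0, h) \<in> A O Z" and h: "(h, h) \<in> A O Z" and "(h, g1) \<in> A O Z"
      using idempotent_reflexive_interpolation [OF finE idemE] by metis
    have lh: "(l, h) \<in> Z"
      using \<open>(l, g0) \<in> Z\<close> \<open>(g0, h) \<in> A O Z\<close> ZE by blast
    have "(k, h) \<in> A O Z"
      using kl lh by blast
    moreover have "A O Z \<subseteq> M O A O Z"
      using M by blast
    ultimately have "(h, k) \<in> A O Z"
      using symP rowsP h by (meson symD subsetD)
    then have "(h, j) \<in> A"
      using kj EA by blast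
    moreover have "(i, h) \<in> A O Z"
      using il lh by blast
    ultimately show "(i, j) \<in> A"
      using EA by blast
  qed
  show "A \<subseteq> A O N O A\<inverse> O M O A"
    using M N by (rule subset_relcomp_weights)
qed

text \<open>
  Inserting \<open>A\<^sup>T = A\<^sup>T Z\<^sup>T A\<^sup>T Z\<^sup>T A\<^sup>T\<close> into \<open>N\<^sup>T A\<^sup>T M\<^sup>T\<close> produces the transposes of both symmetric
  products, which turns the whole into \<open>Z (A N A\<^sup>T M A) Z\<close>.
\<close>

lemma weighted_MP_rel_unique:
  assumes MP: "weighted_MP_rel A M N Z" and a: "A O N O A\<inverse> O M O A = A"
  shows "Z = N\<inverse> O A\<inverse> O M\<inverse>"
proof -
  have AZA: "A O Z O A = A" and ZAZ: "Z O A O Z = Z"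
    and P: "(M O A O Z)\<inverse> = M O A O Z" and Q: "(Z O A O N)\<inverse> = Z O A O N"
    using MP unfolding weighted_MP_rel_def by (auto simp: sym_conv_converse_eq)
  have AZA': "A\<inverse> = A\<inverse> O Z\<inverse> O A\<inverse>"
    using AZA by (metis converse_relcomp O_assoc)
  have Q': "N\<inverse> O A\<inverse> O Z\<inverse> = Z O A O N" and P': "Z\<inverse> O A\<inverse> O M\<inverse> = M O A O Z"
    using P Q by (simp_all add: converse_relcomp O_assoc)
  have "N\<inverse> O A\<inverse> O M\<inverse> = N\<inverse> O (A\<inverse> O Z\<inverse> O A\<inverse> O Z\<inverse> O A\<inverse>) O M\<inverse>"
    using AZA' by (metis O_assoc)
  also have "\<dots> = (N\<inverse> O A\<inverse> O Z\<inverse>) O A\<inverse> O Z\<inverse> O A\<inverse> O M\<inverse>"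
    by (simp add: O_assoc)
  also have "\<dots> = Z O (A O N O A\<inverse> O M O A) O Z"
    unfolding P' Q' by (simp add: O_assoc)
  also have "\<dots> = Z"
    using a ZAZ by simp
  finally show ?thesis
    by (rule sym)
qed

text \<open>
  The two weights can be treated separately: deleting one of them shrinks the product, but never
  below \<open>A\<close>; conversely, \<open>A N A\<^sup>T M A\<close> is contained in the product of the two conditions because
  \<open>A\<^sup>T \<subseteq> A\<^sup>T A A\<^sup>T\<close>.
\<close>

lemma absorb_weight_iff:
  assumes M: "Id_on (Domain A) \<subseteq> M" and N: "Id_on (Range A) \<subseteq> N"
  shows "A O N O A\<inverse> O M O A = A \<longleftrightarrow> A O N O A\<inverse> O A = A \<and> A O A\<inverse> O M O A = A"
proof
  have MA: "A \<subseteq> M O A"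
    by (rule subrelI) (use M in blast)
  have AN: "A \<subseteq> A O N"
    by (rule subrelI) (use N in blast)
  assume a: "A O N O A\<inverse> O M O A = A"
  have "A O N O A\<inverse> O A \<subseteq> A O N O A\<inverse> O M O A"
    by (intro relcomp_mono order_refl MA)
  then have n: "A O N O A\<inverse> O A \<subseteq> A"
    unfolding a .
  have "A O A\<inverse> O M O A \<subseteq> (A O N) O A\<inverse> O M O A"
    by (intro relcomp_mono order_refl AN)
  then have m: "A O A\<inverse> O M O A \<subseteq> A"
    unfolding O_assoc a .
  have "A \<subseteq> A O N O A\<inverse> O Id O A"
    using N by (intro subset_relcomp_weights) auto
  moreover have "A \<subseteq> A O Id O A\<inverse> O M O A"
    using M by (intro subset_relcomp_weights) auto
  ultimately show "A O N O A\<inverse> O A = A \<and> A O A\<inverse> O M O A = A"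
    using n m unfolding R_O_Id Id_O_R by (intro conjI equalityI)
next
  assume r: "A O N O A\<inverse> O A = A \<and> A O A\<inverse> O M O A = A"
  have "A O N O A\<inverse> O M O A \<subseteq> (A O N O A\<inverse> O A) O A\<inverse> O M O A"
    by blast
  also have "\<dots> = A"
    using r by simp
  finally show "A O N O A\<inverse> O M O A = A"
    using subset_relcomp_weights [OF M N] by (rule equalityI)
qed

text \<open>
  Since \<open>A\<^sup>T \<subseteq> A\<^sup>T A A\<^sup>T\<close>, the hypothesis already gives \<open>A N A\<^sup>T = A A\<^sup>T\<close>, which is symmetric.
\<close>

lemma absorb_right_weight_converse:
  assumes N: "Id_on (Range A) \<subseteq> N" and eq: "A O N O A\<inverse> O A = A"
  shows "A O N O A\<inverse> = A O A\<inverse>" and "A O N\<inverse> O A\<inverse> O A = A"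
proof -
  have "A O N O A\<inverse> \<subseteq> (A O N O A\<inverse> O A) O A\<inverse>"
    by blast
  then have "A O N O A\<inverse> \<subseteq> A O A\<inverse>"
    using eq by simp
  moreover have "A O A\<inverse> \<subseteq> A O N O A\<inverse>"
    using N by blast
  ultimately show N1: "A O N O A\<inverse> = A O A\<inverse>" by blast
  then have "A O N\<inverse> O A\<inverse> = A O A\<inverse>"
    by (metis converse_converse converse_relcomp O_assoc)
  then show "A O N\<inverse> O A\<inverse> O A = A"
    using N1 eq by (metis O_assoc)
qed

lemma absorb_right_weight_converse_iff:
  assumes "Id_on (Range A) \<subseteq> N"
  shows "A O N\<inverse> O A\<inverse> O A = A \<longleftrightarrow> A O N O A\<inverse> O A = A"
proof -
  have "Id_on (Range A) \<subseteq> N\<inverse>"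
    using assms by blast
  then show ?thesis
    using absorb_right_weight_converse(2) [OF assms]
      absorb_right_weight_converse(2) [of A "N\<inverse>"] by (metis converse_converse)
qed

lemma absorb_left_weight_converse_iff:
  assumes "Id_on (Domain A) \<subseteq> M"
  shows "A O A\<inverse> O M\<inverse> O A = A \<longleftrightarrow> A O A\<inverse> O M O A = A"
proof -
  have dual: "A O A\<inverse> O L O A = A \<longleftrightarrow> A\<inverse> O L\<inverse> O (A\<inverse>)\<inverse> O A\<inverse> = A\<inverse>" for L
    by (metis converse_converse converse_relcomp O_assoc)
  have "Id_on (Range (A\<inverse>)) \<subseteq> M\<inverse>"
    using assms by blast
  then show ?thesis
    unfolding dual by (rule absorb_right_weight_converse_iff)
qed

lemma regular_imp_weighted_MP_rel:
  assumes M: "Id_on (Domain A) \<subseteq> M" and N: "Id_on (Range A) \<subseteq> N"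
    and a: "A O N O A\<inverse> O M O A = A"
  shows "weighted_MP_rel A M N (N\<inverse> O A\<inverse> O M\<inverse>)"
proof -
  have M': "Id_on (Domain A) \<subseteq> M\<inverse>" and N': "Id_on (Range A) \<subseteq> N\<inverse>"
    using M N by blast+
  have nm: "A O N O A\<inverse> O A = A \<and> A O A\<inverse> O M O A = A"
    using a unfolding absorb_weight_iff [OF M N] .
  note n = nm [THEN conjunct1] and m = nm [THEN conjunct2]
  have n': "A O N\<inverse> O A\<inverse> O A = A"
    using n unfolding absorb_right_weight_converse_iff [OF N] .
  have m': "A O A\<inverse> O M\<inverse> O A = A"
    using m unfolding absorb_left_weight_converse_iff [OF M] .
  have d: "A O N\<inverse> O A\<inverse> O M\<inverse> O A = A"
    unfolding absorb_weight_iff [OF M' N'] using n' m' by (rule conjI)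
  have a': "A\<inverse> O M\<inverse> O A O N\<inverse> O A\<inverse> = A\<inverse>"
    using arg_cong [OF a, of converse] by (simp add: converse_relcomp O_assoc)
  have ANA: "A O N\<inverse> O A\<inverse> = A O A\<inverse>" "A O N O A\<inverse> = A O A\<inverse>"
    by (rule absorb_right_weight_converse(1) [OF N' n'] absorb_right_weight_converse(1) [OF N n])+
  have AMA: "A\<inverse> O M\<inverse> O A = A\<inverse> O A" "A\<inverse> O M O A = A\<inverse> O A"
  proof -
    have "A\<inverse> O M\<inverse> O (A\<inverse>)\<inverse> O A\<inverse> = A\<inverse>"
      using arg_cong [OF m, of converse] by (simp add: converse_relcomp O_assoc)
    moreover have "Id_on (Range (A\<inverse>)) \<subseteq> M\<inverse>"
      using M by blast
    ultimately show *: "A\<inverse> O M\<inverse> O A = A\<inverse> O A"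
      using absorb_right_weight_converse(1) [of "A\<inverse>" "M\<inverse>"] by simp
    show "A\<inverse> O M O A = A\<inverse> O A"
      using arg_cong [OF *, of converse] by (simp add: converse_relcomp O_assoc)
  qed
  show ?thesis
    unfolding weighted_MP_rel_def
  proof (intro conjI)
    show "A O (N\<inverse> O A\<inverse> O M\<inverse>) O A = A"
      using d by (simp add: O_assoc)
    have "(N\<inverse> O A\<inverse> O M\<inverse>) O A O N\<inverse> O A\<inverse> O M\<inverse>
        = N\<inverse> O (A\<inverse> O M\<inverse> O A O N\<inverse> O A\<inverse>) O M\<inverse>"
      by (simp add: O_assoc)
    then show "(N\<inverse> O A\<inverse> O M\<inverse>) O A O N\<inverse> O A\<inverse> O M\<inverse> = N\<inverse> O A\<inverse> O M\<inverse>"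
      using a' by simp
    have "M O A O N\<inverse> O A\<inverse> O M\<inverse> = M O (A O N\<inverse> O A\<inverse>) O M\<inverse>"
      by (simp add: O_assoc)
    then show "sym (M O A O N\<inverse> O A\<inverse> O M\<inverse>)"
      by (simp add: ANA sym_conv_converse_eq converse_relcomp O_assoc)
    have "(N\<inverse> O A\<inverse> O M\<inverse>) O A O N = N\<inverse> O (A\<inverse> O M\<inverse> O A) O N"
      by (simp add: O_assoc)
    then show "sym ((N\<inverse> O A\<inverse> O M\<inverse>) O A O N)"
      by (simp add: AMA sym_conv_converse_eq converse_relcomp O_assoc)
  qed
qed

lemma regular_weight_converse_iff:
  assumes M: "Id_on (Domain A) \<subseteq> M" and N: "Id_on (Range A) \<subseteq> N"
  shows "A O N\<inverse> O A\<inverse> O M O A = A \<longleftrightarrow> A O N O A\<inverse> O M O A = A"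
    and "A O N O A\<inverse> O M\<inverse> O A = A \<longleftrightarrow> A O N O A\<inverse> O M O A = A"
    and "A O N\<inverse> O A\<inverse> O M\<inverse> O A = A \<longleftrightarrow> A O N O A\<inverse> O M O A = A"
proof -
  have M': "Id_on (Domain A) \<subseteq> M\<inverse>" and N': "Id_on (Range A) \<subseteq> N\<inverse>"
    using M N by blast+
  note iffs = absorb_right_weight_converse_iff [OF N] absorb_left_weight_converse_iff [OF M]
  show "A O N\<inverse> O A\<inverse> O M O A = A \<longleftrightarrow> A O N O A\<inverse> O M O A = A"
    unfolding absorb_weight_iff [OF M N] absorb_weight_iff [OF M N'] iffs ..
  show "A O N O A\<inverse> O M\<inverse> O A = A \<longleftrightarrow> A O N O A\<inverse> O M O A = A"
    unfolding absorb_weight_iff [OF M N] absorb_weight_iff [OF M' N] iffs ..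
  show "A O N\<inverse> O A\<inverse> O M\<inverse> O A = A \<longleftrightarrow> A O N O A\<inverse> O M O A = A"
    unfolding absorb_weight_iff [OF M N] absorb_weight_iff [OF M' N'] iffs ..
qed

section \<open>Boolean tensors as relations between multi-indices\<close>

lemma finite_multi_indices: "finite (multi_indices ds)"
proof (induction ds)
  case (Cons d ds)
  have "multi_indices (d # ds) = (\<lambda>(i, is). i # is) ` ({..<d} \<times> multi_indices ds)"
    by (auto simp: multi_indices_def list_all2_Cons2)
  then show ?case
    using Cons by simp
qed (simp add: multi_indices_def)

lemma length_multi_indices: "is \<in> multi_indices ds \<Longrightarrow> length is = length ds"
  by (simp add: multi_indices_def list_all2_lengthD)

lemma append_multi_indices_iff:
  "length is = length ds \<Longrightarrow>
    is @ js \<in> multi_indices (ds @ es) \<longleftrightarrow> is \<in> multi_indices ds \<and> js \<in> multi_indices es"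
  by (simp add: multi_indices_def list_all2_append)

text \<open>
  The length of the row index is prescribed because the split of a multi-index \<open>is @ js\<close> into its row
  and column part would otherwise be ambiguous.
\<close>

definition represents :: "nat list \<Rightarrow> nat list \<Rightarrow> btensor \<Rightarrow> (nat list \<times> nat list) set \<Rightarrow> bool" where
  "represents Is Js A R \<longleftrightarrow>
     dims A = Is @ Js \<and> R = {(is, js). length is = length Is \<and> entry A (is @ js)}"

lemma represents_subset:
  assumes "represents Is Js A R"
  shows "R \<subseteq> multi_indices Is \<times> multi_indices Js"
proof (rule subrelI)
  fix i j assume "(i, j) \<in> R"
  then have "length i = length Is" "i @ j \<in> multi_indices (Is @ Js)"
    using assms entry_outside [of "i @ j" A] by (auto simp: represents_def)
  then show "(i, j) \<in> multi_indices Is \<times> multi_indices Js"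
    by (simp add: append_multi_indices_iff)
qed

lemma represents_iff:
  "represents Is Js A R \<Longrightarrow> (i, j) \<in> R \<longleftrightarrow> length i = length Is \<and> entry A (i @ j)"
  by (simp add: represents_def)

lemma represents_dims: "represents Is Js A R \<Longrightarrow> dims A = Is @ Js"
  by (simp add: represents_def)

lemma represents_finite: "represents Is Js A R \<Longrightarrow> finite R"
  by (meson represents_subset finite_cartesian_product finite_multi_indices finite_subset)

lemma represents_eq_iff:
  assumes "represents Is Js A R" and "represents Is Js B S"
  shows "A = B \<longleftrightarrow> R = S"
proof
  assume "R = S"
  show "A = B"
  proof (rule btensor_eqI)
    show "dims A = dims B"
      using assms by (simp add: represents_def)
    fix "is" assume "is \<in> multi_indices (dims A)"
    then have "length is = length Is + length Js"
      using assms by (simp add: represents_def length_multi_indices)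
    then have "(take (length Is) is, drop (length Is) is) \<in> R \<longleftrightarrow> entry A is"
      "(take (length Is) is, drop (length Is) is) \<in> S \<longleftrightarrow> entry B is"
      using assms by (auto simp: represents_def)
    then show "entry A is = entry B is"
      using \<open>R = S\<close> by simp
  qed
qed (use assms in \<open>simp add: represents_def\<close>)

lemma represents_einstein:
  assumes A: "represents Is Js A R" and B: "represents Js Ks B S"
  shows "represents Is Ks (A \<star>\<^bsub>length Js\<^esub> B) (R O S)"
proof -
  have "(i, k) \<in> R O S \<longleftrightarrow> length i = length Is \<and> entry (A \<star>\<^bsub>length Js\<^esub> B) (i @ k)" for i k
  proof -
    have "(i, k) \<in> R O S \<longleftrightarrow> i \<in> multi_indices Is \<and> k \<in> multi_indices Ks \<and>
        (\<exists>j \<in> multi_indices Js. (i, j) \<in> R \<and> (j, k) \<in> S)"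
      using represents_subset [OF A] represents_subset [OF B] by blast
    then show ?thesis
      by (auto simp: represents_iff [OF A] represents_iff [OF B] represents_dims [OF A]
          represents_dims [OF B] einstein_def Let_def append_multi_indices_iff
          length_multi_indices)
  qed
  moreover have "dims (A \<star>\<^bsub>length Js\<^esub> B) = Is @ Ks"
    by (simp add: represents_dims [OF A] represents_dims [OF B] einstein_def Let_def)
  ultimately show ?thesis
    by (simp add: represents_def set_eq_iff)
qed

lemma represents_ttranspose:
  assumes A: "represents Is Js A R"
  shows "represents Js Is (ttranspose (length Is) A) (R\<inverse>)"
proof -
  have "(j, i) \<in> R\<inverse> \<longleftrightarrow> length j = length Js \<and> entry (ttranspose (length Is) A) (j @ i)" for i j
    using A represents_subset [OF A]
    by (auto simp: represents_def ttranspose_def Let_def append_multi_indices_iff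
        length_multi_indices)
  moreover have "dims (ttranspose (length Is) A) = Js @ Is"
    using A by (simp add: represents_def ttranspose_def Let_def)
  ultimately show ?thesis
    by (auto simp: represents_def)
qed

lemma ident_le_imp_Id_on:
  assumes M: "represents Is Is M R" and "M \<ge> ident Is"
  shows "Id_on (multi_indices Is) \<subseteq> R"
proof
  fix p assume "p \<in> Id_on (multi_indices Is)"
  then obtain i where p: "p = (i, i)" and i: "i \<in> multi_indices Is"
    by blast
  then have "i @ i \<in> multi_indices (Is @ Is)" and len: "length i = length Is"
    by (simp_all add: append_multi_indices_iff length_multi_indices)
  then have "entry M (i @ i)"
    using assms(2) by (auto simp: less_eq_btensor_def ident_def nth_append)
  then show "p \<in> R"
    using M p len by (simp add: represents_def)
qed

lemma trange_represents:
  "represents Is Js A R \<Longrightarrow> trange (length Js) A = {A \<star>\<^bsub>length Js\<^esub> X | X. dims X = Js}"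
  by (simp add: trange_def represents_dims)

text \<open>
  The columns of \<open>A\<close> are its products with the unit vectors, so they lie in the range of \<open>B\<close>; the
  coefficient vectors of the columns, put side by side, form the factor.
\<close>

lemma trange_subset_imp_factor:
  assumes A: "represents Is Js A R" and B: "represents Is Ks B S"
    and sub: "trange (length Js) A \<subseteq> trange (length Ks) B"
  obtains X where "R = S O X"
proof -
  have "\<exists>T. R\<inverse> `` {j} = S\<inverse> `` T" if j: "j \<in> multi_indices Js" for j
  proof -
    define e where "e = tensor Js (\<lambda>is. is = j)"
    have e: "represents Js [] e {(j, [])}"
      using j by (auto simp: represents_def e_def length_multi_indices
          dest: length_multi_indices [of "_ @ _"])
    have "A \<star>\<^bsub>length Js\<^esub> e \<in> trange (length Js) A"
      unfolding trange_represents [OF A] using represents_dims [OF e] by auto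
    then obtain x where x: "dims x = Ks" "A \<star>\<^bsub>length Js\<^esub> e = B \<star>\<^bsub>length Ks\<^esub> x"
      using sub unfolding trange_represents [OF B] by blast
    define T where "T = {(is, js). length is = length Ks \<and> entry x (is @ js)}"
    have "represents Ks [] x T"
      using x(1) by (simp add: represents_def T_def)
    then have "A \<star>\<^bsub>length Js\<^esub> e = B \<star>\<^bsub>length Ks\<^esub> x \<longleftrightarrow> R O {(j, [])} = S O T"
      by (intro represents_eq_iff [of Is "[]"] represents_einstein A B e)
    then have "R O {(j, [])} = S O T"
      using x(2) by simp
    then have "R\<inverse> `` {j} = S\<inverse> `` {t. (t, []) \<in> T}"
      by blast
    then show ?thesis ..
  qed
  then obtain T where T: "\<And>j. j \<in> multi_indices Js \<Longrightarrow> R\<inverse> `` {j} = S\<inverse> `` T j"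
    by metis
  have "R = S O {(k, j). j \<in> multi_indices Js \<and> k \<in> T j}"
    using T represents_subset [OF A] by blast
  then show ?thesis
    by (rule that)
qed

lemma weighted_MP_iff_rel:
  assumes "represents Is Js A R" "represents Is Is M P" "represents Js Js N Q"
    and "represents Js Is Z S"
  shows "weighted_MP (length Is) (length Js) A M N Z \<longleftrightarrow> weighted_MP_rel R P Q S"
proof -
  note r = represents_einstein represents_ttranspose assms
  have "A \<star>\<^bsub>length Js\<^esub> Z \<star>\<^bsub>length Is\<^esub> A = A \<longleftrightarrow> (R O S) O R = R"
    by (intro represents_eq_iff [of Is Js] r)
  moreover have "Z \<star>\<^bsub>length Is\<^esub> A \<star>\<^bsub>length Js\<^esub> Z = Z \<longleftrightarrow> (S O R) O S = S"
    by (intro represents_eq_iff [of Js Is] r)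
  moreover have "ttranspose (length Is) (M \<star>\<^bsub>length Is\<^esub> A \<star>\<^bsub>length Js\<^esub> Z)
      = M \<star>\<^bsub>length Is\<^esub> A \<star>\<^bsub>length Js\<^esub> Z \<longleftrightarrow> ((P O R) O S)\<inverse> = (P O R) O S"
    by (intro represents_eq_iff [of Is Is] r)
  moreover have "ttranspose (length Js) (Z \<star>\<^bsub>length Is\<^esub> A \<star>\<^bsub>length Js\<^esub> N)
      = Z \<star>\<^bsub>length Is\<^esub> A \<star>\<^bsub>length Js\<^esub> N \<longleftrightarrow> ((S O R) O Q)\<inverse> = (S O R) O Q"
    by (intro represents_eq_iff [of Js Js] r)
  ultimately show ?thesis
    using assms
    by (simp add: weighted_MP_def weighted_MP_rel_def represents_def sym_conv_converse_eq O_assoc)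
qed

theorem theorem3p32:
  fixes Is Js :: "nat list" and m n :: nat and A M N :: btensor
  assumes "length Is = m" and "length Js = n"
    and "dims A = Is @ Js" and "dims M = Is @ Is" and "dims N = Js @ Js"
    and "trange n A = trange n (A \<star>\<^bsub>n\<^esub> N)"
    and "trange m (ttranspose m A) = trange m (ttranspose m A \<star>\<^bsub>m\<^esub> ttranspose m M)"
    and "M \<ge> ident Is" and "N \<ge> ident Js"
  shows "((\<exists>Z. weighted_MP m n A M N Z) \<longleftrightarrow>
            A \<star>\<^bsub>n\<^esub> N \<star>\<^bsub>n\<^esub> ttranspose m A \<star>\<^bsub>m\<^esub> M \<star>\<^bsub>m\<^esub> A = A) \<and>
         ((\<exists>Z. weighted_MP m n A M N Z) \<longleftrightarrow>
            A \<star>\<^bsub>n\<^esub> ttranspose n N \<star>\<^bsub>n\<^esub> ttranspose m A \<star>\<^bsub>m\<^esub> M \<star>\<^bsub>m\<^esub> A = A) \<and>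
         ((\<exists>Z. weighted_MP m n A M N Z) \<longleftrightarrow>
            A \<star>\<^bsub>n\<^esub> N \<star>\<^bsub>n\<^esub> ttranspose m A \<star>\<^bsub>m\<^esub> ttranspose m M \<star>\<^bsub>m\<^esub> A = A) \<and>
         ((\<exists>Z. weighted_MP m n A M N Z) \<longleftrightarrow>
            A \<star>\<^bsub>n\<^esub> ttranspose n N \<star>\<^bsub>n\<^esub> ttranspose m A \<star>\<^bsub>m\<^esub> ttranspose m M \<star>\<^bsub>m\<^esub> A = A) \<and>
         (\<forall>Z. weighted_MP m n A M N Z \<longrightarrow>
            Z = ttranspose n N \<star>\<^bsub>n\<^esub> ttranspose m A \<star>\<^bsub>m\<^esub> ttranspose m M)"
proof -
  have [simp]: "m = length Is" "n = length Js"
    using assms(1,2) by simp_all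
  define a p q where "a = {(is, js). length is = length Is \<and> entry A (is @ js)}"
    and "p = {(is, js). length is = length Is \<and> entry M (is @ js)}"
    and "q = {(is, js). length is = length Js \<and> entry N (is @ js)}"
  have A: "represents Is Js A a" and M: "represents Is Is M p" and N: "represents Js Js N q"
    using assms(3-5) by (simp_all add: represents_def a_def p_def q_def)
  note r = represents_einstein represents_ttranspose A M N
  have p: "Id_on (Domain a) \<subseteq> p" and q: "Id_on (Range a) \<subseteq> q"
    using ident_le_imp_Id_on [OF M assms(8)] ident_le_imp_Id_on [OF N assms(9)]
      represents_subset [OF A] by blast+
  obtain y where y: "a = (a O q) O y"
    by (rule trange_subset_imp_factor [of Is Js A a Js "A \<star>\<^bsub>n\<^esub> N"])
      (use assms(6) in \<open>auto intro!: r\<close>)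
  \<comment> \<open>Transposing the factorisation of \<open>a\<inverse>\<close> puts the weight \<open>p\<close> itself to the left of \<open>a\<close>.\<close>
  obtain x where "a\<inverse> = (a\<inverse> O p\<inverse>) O x"
    by (rule trange_subset_imp_factor
        [of Js Is "ttranspose m A" "a\<inverse>" Is "ttranspose m A \<star>\<^bsub>m\<^esub> ttranspose m M"])
      (use assms(7) in \<open>auto intro!: r\<close>)
  then have x: "a = x\<inverse> O p O a"
    by (metis converse_converse converse_relcomp O_assoc)
  have necessary: "a O q O a\<inverse> O p O a = a \<and>
      Z = ttranspose n N \<star>\<^bsub>n\<^esub> ttranspose m A \<star>\<^bsub>m\<^esub> ttranspose m M"
    if "weighted_MP m n A M N Z" for Z
  proof -
    define z where "z = {(is, js). length is = length Js \<and> entry Z (is @ js)}"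
    have Z: "represents Js Is Z z"
      using that assms(3) by (simp add: weighted_MP_def represents_def z_def)
    with that have MP: "weighted_MP_rel a p q z"
      using weighted_MP_iff_rel [OF A M N] by simp
    have reg: "a O q O a\<inverse> O p O a = a"
      using weighted_MP_rel_imp_regular [OF MP _ _ p q x] y
        represents_finite [OF A] represents_finite [OF Z] by (simp add: O_assoc)
    have "Z = ttranspose n N \<star>\<^bsub>n\<^esub> ttranspose m A \<star>\<^bsub>m\<^esub> ttranspose m M
        \<longleftrightarrow> z = (q\<inverse> O a\<inverse>) O p\<inverse>"
      unfolding \<open>m = length Is\<close> \<open>n = length Js\<close> by (intro represents_eq_iff [of Js Is] r Z)
    with reg show ?thesis
      using weighted_MP_rel_unique [OF MP reg] by (simp add: O_assoc)
  qed
  have "weighted_MP m n A M N (ttranspose n N \<star>\<^bsub>n\<^esub> ttranspose m A \<star>\<^bsub>m\<^esub> ttranspose m M)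
      \<longleftrightarrow> weighted_MP_rel a p q ((q\<inverse> O a\<inverse>) O p\<inverse>)"
    unfolding \<open>m = length Is\<close> \<open>n = length Js\<close> by (intro weighted_MP_iff_rel r)
  then have ex: "(\<exists>Z. weighted_MP m n A M N Z) \<longleftrightarrow> a O q O a\<inverse> O p O a = a"
    using necessary regular_imp_weighted_MP_rel [OF p q] by (metis O_assoc)
  have cond: "A \<star>\<^bsub>n\<^esub> W \<star>\<^bsub>n\<^esub> ttranspose m A \<star>\<^bsub>m\<^esub> V \<star>\<^bsub>m\<^esub> A = A
      \<longleftrightarrow> a O w O a\<inverse> O v O a = a"
    if "represents Js Js W w" and "represents Is Is V v" for V v W w
  proof -
    have "A \<star>\<^bsub>n\<^esub> W \<star>\<^bsub>n\<^esub> ttranspose m A \<star>\<^bsub>m\<^esub> V \<star>\<^bsub>m\<^esub> A = A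
      \<longleftrightarrow> (((a O w) O a\<inverse>) O v) O a = a"
      unfolding \<open>m = length Is\<close> \<open>n = length Js\<close> by (intro represents_eq_iff [of Is Js] r that)
    then show ?thesis
      by (simp add: O_assoc)
  qed
  have Mt: "represents Is Is (ttranspose m M) (p\<inverse>)" and Nt: "represents Js Js (ttranspose n N) (q\<inverse>)"
    using r by simp_all
  show ?thesis
    unfolding ex cond [OF N M] cond [OF Nt M] cond [OF N Mt] cond [OF Nt Mt]
      regular_weight_converse_iff [OF p q]
    using necessary by blast
qed

end
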